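(* Suppose the weights are symmetric, i.e. $(\Omega^{\omega})^\top=\Omega^{\omega}$. Then the potential $J(S)=-\frac12\langle S,\Omega^\omega S\rangle$, $S\in\mathcal{W}$, can be written in the form $$J(S)=\frac12\langle S,L_{\mathcal{G}}S\rangle-\frac12\|S\|^2=\frac14\sum_{i\in\mathcal{I}}\sum_{j\in\mathcal{N}_i}\omega_{ij}\|S_i-S_j\|^2-\frac12\|S\|^2,$$ where $L_{\mathcal{G}}=I_n-\Omega^\omega$. The matrix $L_{\mathcal{G}}$ is symmetric, positive semidefinite and satisfies $L_{\mathcal{G}}\mathbf{1}_n=0$.
   Context: $n,c\in\mathbb{N}$, $\mathcal{I}=\{1,\dots,n\}$, $\mathbf{1}_n=(1,\dots,1)^\top\in\mathbb{R}^n$, $I_n$ is the $n\times n$ identity matrix. $\mathcal{W}$ is the set of matrices $S\in\mathbb{R}^{n\times c}$ with strictly positive entries and rows $S_i$ summing to $1$. $\langle A,B\rangle=\operatorname{tr}(A^\top B)$ and $\|\cdot\|$ is the Frobenius norm for matrices and the Euclidean norm for vectors. $\mathcal{G}=(\mathcal{I},\mathcal{E})$ is an undirected graph, $\mathcal{N}_i=\{k\in\mathcal{I}: ik\in\mathcal{E}\}\cup\{i\}$ (so $k\in\mathcal{N}_i\Leftrightarrow i\in\mathcal{N}_k$). Weights satisfy $\omega_{ik}>0$ for $k\in\mathcal{N}_i$ and $\sum_{k\in\mathcal{N}_i}\omega_{ik}=1$ for every $i$. The averaging matrix $\Omega^\omega\in\mathbb{R}^{n\times n}$ has entries $\Omega^\omega_{ij}=\omega_{ij}$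 if $j\in\mathcal{N}_i$ and $\Omega^\omega_{ij}=0$ otherwise. *)

theory Defs
  imports "HOL-Analysis.Analysis"
begin

text \<open>
  The vertex set is the whole finite type \<open>'n\<close>, so \<open>n = CARD('n)\<close>; likewise \<open>c = CARD('c)\<close>.
  An \<open>n \<times> c\<close> matrix has type \<open>real ^ 'c ^ 'n\<close>: \<open>S $ i\<close> is the row \<open>S\<^sub>i\<close>, and the library
  norm on this type, the root of the sum of the squared Euclidean norms of the rows,
  is the Frobenius norm. An undirected graph is given by a symmetric edge relation; self-loops
  are allowed but have no effect on the closed neighborhoods below.
\<close>

definition assignments :: "(real ^ 'c ^ 'n) set" where
  "assignments = {S. (\<forall>i j. 0 < S $ i $ j) \<and> (\<forall>i. (\<Sum>j\<in>UNIV. S $ i $ j) = 1)}"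

definition frobenius_inner :: "real ^ 'c ^ 'n \<Rightarrow> real ^ 'c ^ 'n \<Rightarrow> real" where
  "frobenius_inner A B = trace (transpose A ** B)"

definition nbhd :: "('n \<times> 'n) set \<Rightarrow> 'n \<Rightarrow> 'n set" where
  "nbhd E i = {k. (i, k) \<in> E} \<union> {i}"

text \<open>Values \<open>\<omega> i k\<close> with \<open>k \<notin> nbhd E i\<close> are unconstrained and never used.\<close>

definition averaging_weights :: "('n \<times> 'n) set \<Rightarrow> ('n \<Rightarrow> 'n \<Rightarrow> real) \<Rightarrow> bool" where
  "averaging_weights E \<omega> \<longleftrightarrow>
     (\<forall>i. \<forall>k\<in>nbhd E i. 0 < \<omega> i k) \<and> (\<forall>i. (\<Sum>k\<in>nbhd E i. \<omega> i k) = 1)"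

definition averaging_matrix ::
    "('n \<times> 'n) set \<Rightarrow> ('n \<Rightarrow> 'n \<Rightarrow> real) \<Rightarrow> real ^ 'n ^ 'n" where
  "averaging_matrix E \<omega> = (\<chi> i j. if j \<in> nbhd E i then \<omega> i j else 0)"

definition graph_laplacian ::
    "('n \<times> 'n) set \<Rightarrow> ('n \<Rightarrow> 'n \<Rightarrow> real) \<Rightarrow> real ^ 'n ^ 'n" where
  "graph_laplacian E \<omega> = mat 1 - averaging_matrix E \<omega>"

definition potential ::
    "('n \<times> 'n) set \<Rightarrow> ('n \<Rightarrow> 'n \<Rightarrow> real) \<Rightarrow> real ^ 'c ^ 'n \<Rightarrow> real" where
  "potential E \<omega> S = - (1/2) * frobenius_inner S (averaging_matrix E \<omega> ** S)"

text \<open>Symmetry is not part of this predicate; it has to be stated separately.\<close>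

definition positive_semidefinite :: "real ^ 'n ^ 'n \<Rightarrow> bool" where
  "positive_semidefinite A \<longleftrightarrow> (\<forall>x. 0 \<le> x \<bullet> (A *v x))"

end

theory Submission
  imports Defs
begin

text \<open>
  If a symmetric weight matrix \<open>W\<close> has rows summing to one, expanding
  \<open>\<parallel>x\<^sub>i - x\<^sub>j\<parallel>\<^sup>2\<close> shows that the Dirichlet form
  \<open>\<Sum> W\<^sub>i\<^sub>j \<parallel>x\<^sub>i - x\<^sub>j\<parallel>\<^sup>2\<close> is twice the quadratic form of \<open>I - W\<close>. For families in a general
  inner product space this covers at once the rows of an assignment matrix and, for real families,
  positive semidefiniteness.
\<close>

lemma dirichlet_form_eq:
  fixes W :: "real ^ 'n ^ 'n" and x :: "'n::finite \<Rightarrow> 'b::real_inner"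
  assumes sym: "transpose W = W" and row: "\<And>i. (\<Sum>j\<in>UNIV. W $ i $ j) = 1"
  shows "(\<Sum>i\<in>UNIV. \<Sum>j\<in>UNIV. W $ i $ j * (norm (x i - x j))\<^sup>2)
    = 2 * (\<Sum>i\<in>UNIV. \<Sum>j\<in>UNIV. (mat 1 - W) $ i $ j * (x i \<bullet> x j))"
proof -
  have W: "W $ i $ j = W $ j $ i" for i j
    using sym by (metis transpose_def vec_lambda_beta)
  have rows: "(\<Sum>i\<in>UNIV. \<Sum>j\<in>UNIV. W $ i $ j * (x i \<bullet> x i)) = (\<Sum>i\<in>UNIV. x i \<bullet> x i)"
    by (simp add: row flip: sum_distrib_right)
  \<comment> \<open>Only row sums are given; swapping the sums and applying the symmetry of
    \<open>W\<close> turns column sums into row sums.\<close>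
  have cols: "(\<Sum>i\<in>UNIV. \<Sum>j\<in>UNIV. W $ i $ j * (x j \<bullet> x j)) = (\<Sum>i\<in>UNIV. x i \<bullet> x i)"
    by (subst sum.swap, subst W) (rule rows)
  have diag: "(\<Sum>i\<in>UNIV. \<Sum>j\<in>UNIV. mat 1 $ i $ j * (x i \<bullet> x j)) = (\<Sum>i\<in>UNIV. x i \<bullet> x i)"
    by (simp add: mat_def if_distrib [of "\<lambda>t. t * _"] cong: if_cong)
  have "W $ i $ j * (norm (x i - x j))\<^sup>2
      = W $ i $ j * (x i \<bullet> x i) + W $ i $ j * (x j \<bullet> x j) - 2 * (W $ i $ j * (x i \<bullet> x j))" for i j
    by (simp add: power2_norm_eq_inner inner_diff_left inner_diff_right inner_commute algebra_simps)
  then show ?thesis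
    by (simp add: sum.distrib sum_subtractf rows cols diag left_diff_distrib
        flip: sum_distrib_left)
qed

text \<open>The trace adds the entrywise products column by column, the library inner product row by
  row. This ties \<open>frobenius_inner\<close> to \<open>norm\<close>.\<close>

lemma frobenius_inner_eq_inner: "frobenius_inner A B = A \<bullet> B"
  for A B :: "real ^ 'c::finite ^ 'n::finite"
  unfolding frobenius_inner_def trace_def transpose_def matrix_matrix_mult_def inner_vec_def
  by (simp add: sum.swap [of _ "UNIV :: 'c set"])

text \<open>Row \<open>i\<close> of \<open>M ** S\<close> is the combination of the rows of
  \<open>S\<close> with coefficients \<open>M $ i $ j\<close>. The result is a double sum of the
  shape in \<open>dirichlet_form_eq\<close>.\<close>

lemma inner_matrix_mult:
  fixes M :: "real ^ 'n ^ 'n::finite" and S :: "real ^ 'c::finite ^ 'n"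
  shows "S \<bullet> (M ** S) = (\<Sum>i\<in>UNIV. \<Sum>j\<in>UNIV. M $ i $ j * (S $ i \<bullet> S $ j))"
proof -
  have "(M ** S) $ i = (\<Sum>j\<in>UNIV. M $ i $ j *\<^sub>R S $ j)" for i
    by (simp add: matrix_matrix_mult_def vec_eq_iff)
  then show ?thesis
    by (simp add: inner_vec_def [of S] inner_sum_right)
qed

text \<open>The product of two real entries is written as an inner product to match the general form
  with \<open>'b = real\<close>.\<close>

lemma inner_matrix_vector_mult:
  fixes M :: "real ^ 'n ^ 'n::finite" and x :: "real ^ 'n"
  shows "x \<bullet> (M *v x) = (\<Sum>i\<in>UNIV. \<Sum>j\<in>UNIV. M $ i $ j * (x $ i \<bullet> x $ j))"
  by (simp add: inner_vec_def matrix_vector_mult_def sum_distrib_left algebra_simps)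

text \<open>The factor \<open>f\<close> is arbitrary so that one lemma serves both row sums, with
  \<open>f\<close> constantly 1, and Dirichlet forms.\<close>

lemma sum_averaging_matrix:
  fixes E :: "('n::finite \<times> 'n) set"
  shows "(\<Sum>j\<in>UNIV. averaging_matrix E \<omega> $ i $ j * f j) = (\<Sum>j\<in>nbhd E i. \<omega> i j * f j)"
  by (simp add: averaging_matrix_def if_distrib [of "\<lambda>t. t * _"] sum.If_cases cong: if_cong)

lemma averaging_matrix_row_sum:
  fixes E :: "('n::finite \<times> 'n) set"
  assumes "averaging_weights E \<omega>"
  shows "(\<Sum>j\<in>UNIV. averaging_matrix E \<omega> $ i $ j) = 1"
  using assms sum_averaging_matrix [of E \<omega> i "\<lambda>_. 1"] by (simp add: averaging_weights_def)

lemma graph_laplacian_form: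
  fixes E :: "('n::finite \<times> 'n) set" and x :: "'n \<Rightarrow> 'b::real_inner"
  assumes "averaging_weights E \<omega>" "transpose (averaging_matrix E \<omega>) = averaging_matrix E \<omega>"
  shows "(\<Sum>i\<in>UNIV. \<Sum>j\<in>UNIV. graph_laplacian E \<omega> $ i $ j * (x i \<bullet> x j))
    = 1/2 * (\<Sum>i\<in>UNIV. \<Sum>j\<in>nbhd E i. \<omega> i j * (norm (x i - x j))\<^sup>2)"
  using dirichlet_form_eq [OF assms(2) averaging_matrix_row_sum [OF assms(1)], of x]
  by (simp add: sum_averaging_matrix graph_laplacian_def)

theorem proposition3p9:
  fixes E :: "('n::finite \<times> 'n) set" and \<omega> :: "'n \<Rightarrow> 'n \<Rightarrow> real"
  assumes "sym E"
    and "averaging_weights E \<omega>"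
    and "transpose (averaging_matrix E \<omega>) = averaging_matrix E \<omega>"
  shows "(\<forall>S \<in> (assignments :: (real ^ 'c::finite ^ 'n) set).
            potential E \<omega> S
              = 1/2 * frobenius_inner S (graph_laplacian E \<omega> ** S) - 1/2 * (norm S)\<^sup>2
          \<and> 1/2 * frobenius_inner S (graph_laplacian E \<omega> ** S) - 1/2 * (norm S)\<^sup>2
              = 1/4 * (\<Sum>i\<in>UNIV. \<Sum>j\<in>nbhd E i. \<omega> i j * (norm (S $ i - S $ j))\<^sup>2)
                - 1/2 * (norm S)\<^sup>2)
       \<and> transpose (graph_laplacian E \<omega>) = graph_laplacian E \<omega>
       \<and> positive_semidefinite (graph_laplacian E \<omega>)
       \<and> graph_laplacian E \<omega> *v (\<chi> i. 1) = 0"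
proof (intro conjI ballI)
  let ?L = "graph_laplacian E \<omega>"
  fix S :: "real ^ 'c ^ 'n"
  \<comment> \<open>Pairing this with \<open>S\<close> gives the norm squared minus the form of the
    averaging matrix, hence the first formula for the potential.\<close>
  have "?L ** S = S - averaging_matrix E \<omega> ** S"
    by (simp add: graph_laplacian_def matrix_matrix_mult_def vec_eq_iff mat_def left_diff_distrib
        sum_subtractf if_distrib [of "\<lambda>t. t * _"] cong: if_cong)
  then show "potential E \<omega> S = 1/2 * frobenius_inner S (?L ** S) - 1/2 * (norm S)\<^sup>2"
    by (simp add: potential_def frobenius_inner_eq_inner inner_diff_right power2_norm_eq_inner
        diff_divide_distrib)
  \<comment> \<open>The factor 1/4 is the 1/2 in front of the form times the 1/2 from
    \<open>graph_laplacian_form\<close>, applied to the rows of \<open>S\<close>.\<close>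
  show "1/2 * frobenius_inner S (?L ** S) - 1/2 * (norm S)\<^sup>2
      = 1/4 * (\<Sum>i\<in>UNIV. \<Sum>j\<in>nbhd E i. \<omega> i j * (norm (S $ i - S $ j))\<^sup>2) - 1/2 * (norm S)\<^sup>2"
    by (simp add: frobenius_inner_eq_inner inner_matrix_mult graph_laplacian_form [OF assms(2,3)])
next
  show "transpose (graph_laplacian E \<omega>) = graph_laplacian E \<omega>"
    using assms(3) by (auto simp: graph_laplacian_def transpose_def vec_eq_iff mat_def)
next
  have "0 \<le> (\<Sum>i\<in>UNIV. \<Sum>j\<in>nbhd E i. \<omega> i j * (norm (x $ i - x $ j))\<^sup>2)" for x :: "real ^ 'n"
    using assms(2) by (intro sum_nonneg) (auto simp: averaging_weights_def less_imp_le)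
  \<comment> \<open>\<open>simp only\<close> keeps the real inner products from becoming plain
    products before \<open>graph_laplacian_form\<close> rewrites them.\<close>
  then show "positive_semidefinite (graph_laplacian E \<omega>)"
    by (simp only: positive_semidefinite_def inner_matrix_vector_mult
        graph_laplacian_form [OF assms(2,3)]) simp
next
  have "averaging_matrix E \<omega> *v (\<chi> i. 1) = (\<chi> i. 1)"
    by (simp add: matrix_vector_mult_def averaging_matrix_row_sum [OF assms(2)])
  then show "graph_laplacian E \<omega> *v (\<chi> i. 1) = 0"
    by (simp add: graph_laplacian_def matrix_vector_mult_diff_rdistrib)
qed

end
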